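(* Let $V$ be a finite-dimensional module over $\mathrm{QAWA}_2(A_R;z)$. Then every eigenvalue (in $\mathbb{K}$) of $x_2$ on $V$ is either an eigenvalue $\lambda$ of $x_1$ on $V$, or of the form $\gamma\lambda$ for some $\gamma\in\Gamma_R$ and some eigenvalue $\lambda$ of $x_1$ on $V$.
   Context: Let $\Bbbk$ be a commutative ring, $z\in\Bbbk^\times$, and $A$ a symmetric Frobenius superalgebra over $\Bbbk$ with even trace $\mathrm{tr}$, homogeneous basis $B_A$ and dual basis $\{b^\vee\}$, $\mathrm{tr}(b^\vee c)=\delta_{b,c}$. Let $\mathbb{K}\supseteq\Bbbk$ be an algebraically closed field and $R$ a finite-dimensional supercommutative superalgebra over $\mathbb{K}$; set $A_R:=R\otimes_\Bbbk A$ (a symmetric Frobenius superalgebra over $R$ with trace $\mathrm{id}\otimes\mathrm{tr}$). $\mathrm{QAWA}_2(A_R;z)$ is the $R$-superalgebra generated by $A_R\otimes_RA_R$ (factors numbered right to left, $a^{(1)}=1\otimes a$, $a^{(2)}=a\otimes1$), commuting even invertible $x_1,x_2$, and even $\sigma_1$, with relations $\sigma_1^2=z\tau_1\sigma_1+1$ where $\tau_1:=\sum_{b\in B_A}b\otimes b^\vee$, $\sigma_1\mathbf a=s_1(\mathbf a)\sigma_1$ ($s_1$ the superswap of the two factors), $\sigma_1x_1\sigma_1=x_2$, $x_i\mathbf a=\mathbf ax_i$. Let $m(w)\in\mathbb{K}[w]$ be the minimal polynomial of the $\mathbb{K}$-linear endomorphism of $A_R\otimes_RA_R$ given by left multiplication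 by $z\tau_1$. $\Gamma_R$ is the subgroup of $\mathbb{K}^\times$ generated by $\{\mu/(\mu-\eta):\mu,\eta\in\mathbb{K},\ m(\eta)=0,\ \mu^2-\mu\eta-1=0\}$. *)

theory Defs
  imports "Jordan_Normal_Form.Char_Poly"
begin

text \<open>Sign rule for super (Z/2-graded) objects; parity True = odd.\<close>
definition psign :: "bool \<Rightarrow> bool \<Rightarrow> 'a::comm_ring_1" where
  "psign p q = (if p \<and> q then -1 else 1)"

text \<open>An injective unital ring homomorphism (the inclusion of the ground ring into the field K).\<close>
definition ring_embedding :: "('k::comm_ring_1 \<Rightarrow> 'K::field) \<Rightarrow> bool" where
  "ring_embedding \<iota> \<longleftrightarrow> \<iota> 0 = 0 \<and> \<iota> 1 = 1 \<and> (\<forall>a b. \<iota> (a + b) = \<iota> a + \<iota> b)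
     \<and> (\<forall>a b. \<iota> (a * b) = \<iota> a * \<iota> b) \<and> inj \<iota>"

definition alg_closed_field :: "'K::field itself \<Rightarrow> bool" where
  "alg_closed_field TYPE('K) \<longleftrightarrow> (\<forall>p::'K poly. degree p > 0 \<longrightarrow> (\<exists>x. poly p x = 0))"

text \<open>An associative unital superalgebra, free over the scalars with finite homogeneous basis
  indexed by the finite type 'i: e_i e_j = sum_k m i j k e_k, 1 = sum_k u k e_k,
  p i = parity of e_i (True = odd).\<close>
definition superalg :: "('i::finite \<Rightarrow> 'i \<Rightarrow> 'i \<Rightarrow> 'a::comm_ring_1) \<Rightarrow> ('i \<Rightarrow> 'a) \<Rightarrow> ('i \<Rightarrow> bool) \<Rightarrow> bool" where
  "superalg m u p \<longleftrightarrow>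
     (\<forall>i j l s. (\<Sum>k\<in>UNIV. m i j k * m k l s) = (\<Sum>k\<in>UNIV. m j l k * m i k s))
   \<and> (\<forall>i s. (\<Sum>k\<in>UNIV. u k * m k i s) = (if i = s then 1 else 0))
   \<and> (\<forall>i s. (\<Sum>k\<in>UNIV. u k * m i k s) = (if i = s then 1 else 0))
   \<and> (\<forall>i j k. m i j k \<noteq> 0 \<longrightarrow> (p k \<longleftrightarrow> p i \<noteq> p j))
   \<and> (\<forall>k. u k \<noteq> 0 \<longrightarrow> \<not> p k)"

definition supercomm_superalg :: "('i::finite \<Rightarrow> 'i \<Rightarrow> 'i \<Rightarrow> 'a::comm_ring_1) \<Rightarrow> ('i \<Rightarrow> 'a) \<Rightarrow> ('i \<Rightarrow> bool) \<Rightarrow> bool" where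
  "supercomm_superalg m u p \<longleftrightarrow> superalg m u p \<and> (\<forall>i j k. m i j k = psign (p i) (p j) * m j i k)"

text \<open>tr(e_b e_c), where tr is given by its values on the basis.\<close>
definition trprod :: "('b::finite \<Rightarrow> 'b \<Rightarrow> 'b \<Rightarrow> 'k::comm_ring_1) \<Rightarrow> ('b \<Rightarrow> 'k) \<Rightarrow> 'b \<Rightarrow> 'b \<Rightarrow> 'k" where
  "trprod m tr b c = (\<Sum>d\<in>UNIV. m b c d * tr d)"

text \<open>Symmetric Frobenius superalgebra with even trace tr, homogeneous basis (indexed by 'b)
  and dual basis b\<or> = sum_c dual b c e_c with tr(b\<or> c) = delta.\<close>
definition sym_frob_superalg :: "('b::finite \<Rightarrow> 'b \<Rightarrow> 'b \<Rightarrow> 'k::comm_ring_1) \<Rightarrow> ('b \<Rightarrow> 'k) \<Rightarrow> ('b \<Rightarrow> bool)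
     \<Rightarrow> ('b \<Rightarrow> 'k) \<Rightarrow> ('b \<Rightarrow> 'b \<Rightarrow> 'k) \<Rightarrow> bool" where
  "sym_frob_superalg m u p tr dual \<longleftrightarrow> superalg m u p
   \<and> (\<forall>b. p b \<longrightarrow> tr b = 0)
   \<and> (\<forall>b c. trprod m tr b c = psign (p b) (p c) * trprod m tr c b)
   \<and> (\<forall>b c. (\<Sum>d\<in>UNIV. dual b d * trprod m tr d c) = (if b = c then 1 else 0))"

text \<open>Structure constants of A_R \<otimes>_R A_R = R \<otimes> A \<otimes> A (super tensor product) over K,
  with K-basis e_(r,a,b) = r \<otimes> a \<otimes> b (a in tensor factor 2, b in factor 1).\<close>
definition tmul :: "('r \<Rightarrow> 'r \<Rightarrow> 'r \<Rightarrow> 'K::field) \<Rightarrow> ('r \<Rightarrow> bool) \<Rightarrow> ('b \<Rightarrow> 'b \<Rightarrow> 'b \<Rightarrow> 'k::comm_ring_1) \<Rightarrow> ('b \<Rightarrow> bool)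
     \<Rightarrow> ('k \<Rightarrow> 'K) \<Rightarrow> 'r \<times> 'b \<times> 'b \<Rightarrow> 'r \<times> 'b \<times> 'b \<Rightarrow> 'r \<times> 'b \<times> 'b \<Rightarrow> 'K" where
  "tmul mR pR mA pA \<iota> x y w = (case x of (r, a, b) \<Rightarrow> case y of (r', a', b') \<Rightarrow> case w of (r'', a'', b'') \<Rightarrow>
     psign (pA b) (pR r') * psign (pA a) (pR r') * psign (pA b) (pA a')
       * mR r r' r'' * \<iota> (mA a a' a'') * \<iota> (mA b b' b''))"

definition tunit :: "('r \<Rightarrow> 'K::field) \<Rightarrow> ('b \<Rightarrow> 'k::comm_ring_1) \<Rightarrow> ('k \<Rightarrow> 'K) \<Rightarrow> 'r \<times> 'b \<times> 'b \<Rightarrow> 'K" where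
  "tunit uR uA \<iota> w = (case w of (r, a, b) \<Rightarrow> uR r * \<iota> (uA a) * \<iota> (uA b))"

text \<open>Coordinates of tau_1 = sum_b b \<otimes> b\<or> (i.e. 1_R \<otimes> b \<otimes> b\<or>).\<close>
definition ttau :: "('r \<Rightarrow> 'K::field) \<Rightarrow> ('b \<Rightarrow> 'b \<Rightarrow> 'k::comm_ring_1) \<Rightarrow> ('k \<Rightarrow> 'K) \<Rightarrow> 'r \<times> 'b \<times> 'b \<Rightarrow> 'K" where
  "ttau uR dual \<iota> w = (case w of (r, a, b) \<Rightarrow> uR r * \<iota> (dual a b))"

text \<open>Multiplication in an algebra given by structure constants, on coordinate vectors.\<close>
definition cmult :: "('i::finite \<Rightarrow> 'i \<Rightarrow> 'i \<Rightarrow> 'K::field) \<Rightarrow> ('i \<Rightarrow> 'K) \<Rightarrow> ('i \<Rightarrow> 'K) \<Rightarrow> 'i \<Rightarrow> 'K" where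
  "cmult m u v = (\<lambda>k. \<Sum>i\<in>UNIV. \<Sum>j\<in>UNIV. u i * v j * m i j k)"

text \<open>Evaluation of a polynomial at a K-linear endomorphism f of K^'i.\<close>
definition op_poly :: "'K::field poly \<Rightarrow> (('i \<Rightarrow> 'K) \<Rightarrow> ('i \<Rightarrow> 'K)) \<Rightarrow> ('i \<Rightarrow> 'K) \<Rightarrow> ('i \<Rightarrow> 'K)" where
  "op_poly q f v = (\<lambda>i. \<Sum>k\<le>degree q. coeff q k * (f ^^ k) v i)"

text \<open>m is the minimal polynomial of the linear endomorphism f: monic, annihilates f, and
  divides every polynomial annihilating f.\<close>
definition is_min_poly :: "(('i \<Rightarrow> 'K::field) \<Rightarrow> ('i \<Rightarrow> 'K)) \<Rightarrow> 'K poly \<Rightarrow> bool" where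
  "is_min_poly f m \<longleftrightarrow> lead_coeff m = 1 \<and> (\<forall>v. op_poly m f v = (\<lambda>_. 0))
     \<and> (\<forall>q. (\<forall>v. op_poly q f v = (\<lambda>_. 0)) \<longrightarrow> m dvd q)"

text \<open>The subgroup of the multiplicative group generated by a set S of units.\<close>
inductive_set gen_mult_subgroup :: "'K::field set \<Rightarrow> 'K set" for S where
  one: "1 \<in> gen_mult_subgroup S"
| mul: "x \<in> gen_mult_subgroup S \<Longrightarrow> s \<in> S \<Longrightarrow> x * s \<in> gen_mult_subgroup S"
| mul_inv: "x \<in> gen_mult_subgroup S \<Longrightarrow> s \<in> S \<Longrightarrow> x * inverse s \<in> gen_mult_subgroup S"

definition Gamma_R :: "'K::field poly \<Rightarrow> 'K set" where
  "Gamma_R m = gen_mult_subgroup {\<mu> / (\<mu> - \<eta>) | \<mu> \<eta>. poly m \<eta> = 0 \<and> \<mu>^2 - \<mu> * \<eta> - 1 = 0}"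

text \<open>K-linear combination sum_k c k * M k of n x n matrices.\<close>
definition lincomb_mat :: "nat \<Rightarrow> ('i::finite \<Rightarrow> 'K::field) \<Rightarrow> ('i \<Rightarrow> 'K mat) \<Rightarrow> 'K mat" where
  "lincomb_mat n c M = mat n n (\<lambda>(p, q). \<Sum>k\<in>UNIV. c k * M k $$ (p, q))"

text \<open>A module over QAWA_2(A_R; z) on V = K^n: images rho of the K-basis of A_R \<otimes>_R A_R
  (a K-algebra homomorphism), X1, X2 (images of x1, x2) and S (image of sigma_1),
  satisfying the defining relations.\<close>
definition qawa2_module ::
  "('r::finite \<Rightarrow> 'r \<Rightarrow> 'r \<Rightarrow> 'K::field) \<Rightarrow> ('r \<Rightarrow> 'K) \<Rightarrow> ('r \<Rightarrow> bool)
   \<Rightarrow> ('b::finite \<Rightarrow> 'b \<Rightarrow> 'b \<Rightarrow> 'k::comm_ring_1) \<Rightarrow> ('b \<Rightarrow> 'k) \<Rightarrow> ('b \<Rightarrow> bool) \<Rightarrow> ('b \<Rightarrow> 'b \<Rightarrow> 'k)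
   \<Rightarrow> ('k \<Rightarrow> 'K) \<Rightarrow> 'k \<Rightarrow> nat \<Rightarrow> ('r \<times> 'b \<times> 'b \<Rightarrow> 'K mat) \<Rightarrow> 'K mat \<Rightarrow> 'K mat \<Rightarrow> 'K mat \<Rightarrow> bool" where
  "qawa2_module mR uR pR mA uA pA dual \<iota> z n \<rho> X1 X2 S \<longleftrightarrow>
     (\<forall>i. \<rho> i \<in> carrier_mat n n) \<and> X1 \<in> carrier_mat n n \<and> X2 \<in> carrier_mat n n \<and> S \<in> carrier_mat n n
   \<and> lincomb_mat n (tunit uR uA \<iota>) \<rho> = 1\<^sub>m n
   \<and> (\<forall>i j. \<rho> i * \<rho> j = lincomb_mat n (tmul mR pR mA pA \<iota> i j) \<rho>)
   \<and> invertible_mat X1 \<and> invertible_mat X2 \<and> X1 * X2 = X2 * X1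
   \<and> (\<forall>i. X1 * \<rho> i = \<rho> i * X1) \<and> (\<forall>i. X2 * \<rho> i = \<rho> i * X2)
   \<and> S * S = \<iota> z \<cdot>\<^sub>m (lincomb_mat n (ttau uR dual \<iota>) \<rho> * S) + 1\<^sub>m n
   \<and> (\<forall>r a b. S * \<rho> (r, a, b) = (psign (pA a) (pA b) \<cdot>\<^sub>m \<rho> (r, b, a)) * S)
   \<and> S * X1 * S = X2"

end

theory Submission
  imports Defs
begin

(* Since x1 and x2 commute with A_R (x) A_R, they commute with Z, the action of z tau_1; over the
   algebraically closed field they therefore have a common eigenvector w with
   x2 w = nu w, x1 w = lam w, Z w = eta w, and eta is a root of m because m(Z) is the image of
   m(z tau_1) 1 = 0.  Put s = sigma_1 w.  The relations x2 = sigma_1 x1 sigma_1 and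
   sigma_1^2 = Z sigma_1 + 1 give x1 s = nu s - nu eta w, so y = x1 s - lam s satisfies x1 y = nu y.
   If y <> 0, nu is an eigenvalue of x1.  Otherwise (nu - lam) s = nu eta w; if moreover nu <> lam,
   then s = mu w is an eigenvector of sigma_1, whence mu^2 = mu eta + 1 and nu = mu^2 lam, and
   mu^2 = mu / (mu - eta) lies in Gamma_R. *)

section \<open>Common eigenvectors of commuting matrices\<close>

lemma smult_vec_eq_0_iff:
  fixes v :: "'a::field vec"
  assumes "v \<in> carrier_vec n"
  shows "c \<cdot>\<^sub>v v = 0\<^sub>v n \<longleftrightarrow> c = 0 \<or> v = 0\<^sub>v n"
proof
  assume cv: "c \<cdot>\<^sub>v v = 0\<^sub>v n"
  have "c * v $ i = 0" if "i < n" for i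
    using arg_cong[OF cv, of "\<lambda>x. x $ i"] that assms by simp
  then show "c = 0 \<or> v = 0\<^sub>v n"
    using assms by auto
qed (use assms in auto)

lemma diff_vec_eq_0_iff:
  fixes v w :: "'a::ab_group_add vec"
  assumes "v \<in> carrier_vec n" "w \<in> carrier_vec n"
  shows "v - w = 0\<^sub>v n \<longleftrightarrow> v = w"
proof
  assume vw: "v - w = 0\<^sub>v n"
  have "v $ i = w $ i" if "i < n" for i
    using arg_cong[OF vw, of "\<lambda>x. x $ i"] that assms by simp
  then show "v = w"
    using assms by auto
qed (use assms in auto)

text \<open>The vector \<open>p(B) v\<close>, computed by Horner's rule.\<close>

definition poly_mat_vec :: "'a::field mat \<Rightarrow> 'a poly \<Rightarrow> 'a vec \<Rightarrow> 'a vec" where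
  "poly_mat_vec B p v = fold_coeffs (\<lambda>a w. a \<cdot>\<^sub>v v + B *\<^sub>v w) p (0\<^sub>v (dim_row B))"

context
  fixes B :: "'a::field mat" and v :: "'a vec" and n :: nat
  assumes B: "B \<in> carrier_mat n n" and v: "v \<in> carrier_vec n"
begin

lemma poly_mat_vec_0 [simp]: "poly_mat_vec B 0 v = 0\<^sub>v n"
  using B by (simp add: poly_mat_vec_def)

lemma poly_mat_vec_pCons: "poly_mat_vec B (pCons a p) v = a \<cdot>\<^sub>v v + B *\<^sub>v poly_mat_vec B p v"
proof (cases "a = 0 \<and> p = 0")
  case True
  then show ?thesis using B v by (auto simp: poly_mat_vec_def)
qed (auto simp: poly_mat_vec_def fold_coeffs_def)

lemma poly_mat_vec_carrier [simp]: "poly_mat_vec B p v \<in> carrier_vec n"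
  by (induction p) (use B v in \<open>simp_all add: poly_mat_vec_pCons\<close>)

lemma dim_poly_mat_vec [simp]: "dim_vec (poly_mat_vec B p v) = n"
  using poly_mat_vec_carrier by (rule carrier_vecD)

lemma poly_mat_vec_const: "poly_mat_vec B [:c:] v = c \<cdot>\<^sub>v v"
  using B v by (auto simp: poly_mat_vec_pCons)

lemma poly_mat_vec_add: "poly_mat_vec B (p + q) v = poly_mat_vec B p v + poly_mat_vec B q v"
proof (induction p q rule: poly_induct2)
  case (pCons a p b q)
  then show ?case using B v
    by (auto simp: poly_mat_vec_pCons mult_add_distrib_mat_vec[OF B] add_smult_distrib_vec)
qed simp

lemma poly_mat_vec_smult: "poly_mat_vec B (Polynomial.smult c p) v = c \<cdot>\<^sub>v poly_mat_vec B p v"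
proof (induction p)
  case (pCons a p)
  then show ?case using B v
    by (simp add: poly_mat_vec_pCons mult_mat_vec[OF B] smult_add_distrib_vec[of _ n] smult_smult_assoc
        mult.commute)
qed auto

lemma poly_mat_vec_linear_factor:
  "poly_mat_vec B ([:-\<beta>, 1:] * p) v = B *\<^sub>v poly_mat_vec B p v - \<beta> \<cdot>\<^sub>v poly_mat_vec B p v"
proof -
  have "[:-\<beta>, 1:] * p = pCons 0 p + Polynomial.smult (-\<beta>) p"
    by simp
  then show ?thesis
    using B v by (simp only: poly_mat_vec_add poly_mat_vec_smult poly_mat_vec_pCons) (rule eq_vecI; simp)
qed

lemma funpow_mult_mat_vec_carrier [simp]: "((*\<^sub>v) B ^^ k) v \<in> carrier_vec n"
  by (induction k) (use B v in auto)

lemma poly_mat_vec_monom: "poly_mat_vec B (monom a k) v = a \<cdot>\<^sub>v ((*\<^sub>v) B ^^ k) v"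
  by (induction k) (use B v in \<open>auto simp: monom_0 monom_Suc poly_mat_vec_pCons mult_mat_vec[OF B]\<close>)

lemma poly_mat_vec_commute:
  assumes A: "A \<in> carrier_mat n n" and AB: "A * B = B * A" and Av: "A *\<^sub>v v = \<alpha> \<cdot>\<^sub>v v"
  shows "A *\<^sub>v poly_mat_vec B p v = \<alpha> \<cdot>\<^sub>v poly_mat_vec B p v"
proof (induction p)
  case (pCons a p)
  let ?w = "poly_mat_vec B p v"
  have "A *\<^sub>v (B *\<^sub>v ?w) = B *\<^sub>v (A *\<^sub>v ?w)"
    using A B by (simp flip: assoc_mult_mat_vec add: AB)
  then show ?case
    using A B v by (simp add: poly_mat_vec_pCons mult_add_distrib_mat_vec[OF A] mult_mat_vec
        smult_add_distrib_vec[of _ n] smult_smult_assoc Av pCons mult.commute)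
qed (use A in auto)

lemma poly_mat_vec_sum_index:
  assumes "finite J" and "i < n"
  shows "poly_mat_vec B (\<Sum>j\<in>J. p j) v $ i = (\<Sum>j\<in>J. poly_mat_vec B (p j) v $ i)"
  using assms by (induction J rule: finite_induct) (simp_all add: poly_mat_vec_add)

lemma poly_mat_vec_annihilator_exists: "\<exists>q. q \<noteq> 0 \<and> poly_mat_vec B q v = 0\<^sub>v n"
proof -
  \<comment> \<open>The rows \<open>i < n\<close> of \<open>K\<close> hold the \<open>i\<close>-th coordinates of \<open>v, B v, \<dots>, B\<^sup>n v\<close>; the extra zero
    row makes \<open>K\<close> singular, and a kernel vector of \<open>K\<close> is a linear dependence among these vectors.\<close>
  define K where "K = mat\<^sub>r (Suc n) (Suc n)
    (\<lambda>i. if i = n then 0\<^sub>v (Suc n) else vec (Suc n) (\<lambda>j. ((*\<^sub>v) B ^^ j) v $ i))"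
  have K: "K \<in> carrier_mat (Suc n) (Suc n)"
    by (simp add: K_def)
  have "det K = 0"
    unfolding K_def by (rule det_row_0) auto
  then obtain c where c: "c \<in> carrier_vec (Suc n)" "c \<noteq> 0\<^sub>v (Suc n)" and Kc: "K *\<^sub>v c = 0\<^sub>v (Suc n)"
    using det_0_iff_vec_prod_zero[OF K] by blast
  define q where "q = (\<Sum>j<Suc n. monom (c $ j) j)"
  have coeff_q: "coeff q j = (if j < Suc n then c $ j else 0)" for j
    by (simp add: q_def coeff_sum coeff_monom)
  have "q \<noteq> 0"
  proof
    assume "q = 0"
    then have "c $ j = 0" if "j < Suc n" for j
      using coeff_q[of j] that by simp
    with c show False by auto
  qed
  moreover have "poly_mat_vec B q v = 0\<^sub>v n"
  proof (rule eq_vecI)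
    fix i assume "i < dim_vec (0\<^sub>v n :: 'a vec)"
    then have i: "i < n" by simp
    have "poly_mat_vec B q v $ i = (\<Sum>j<Suc n. c $ j * ((*\<^sub>v) B ^^ j) v $ i)"
      using i by (simp add: q_def poly_mat_vec_sum_index poly_mat_vec_monom
          carrier_vecD[OF funpow_mult_mat_vec_carrier] del: sum.lessThan_Suc)
    also have "\<dots> = (K *\<^sub>v c) $ i"
      using i c by (simp add: K_def scalar_prod_def atLeast0LessThan mult.commute del: sum.lessThan_Suc)
    finally show "poly_mat_vec B q v $ i = 0\<^sub>v n $ i"
      using i Kc by simp
  qed simp
  ultimately show ?thesis by blast
qed

lemma poly_mat_vec_eigenvector_exists:
  assumes closed: "alg_closed_field TYPE('a)" and v0: "v \<noteq> 0\<^sub>v n"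
    and "q \<noteq> 0" and "poly_mat_vec B q v = 0\<^sub>v n"
  shows "\<exists>p \<beta>. poly_mat_vec B p v \<noteq> 0\<^sub>v n \<and> B *\<^sub>v poly_mat_vec B p v = \<beta> \<cdot>\<^sub>v poly_mat_vec B p v"
  using assms(3,4)
proof (induction "degree q" arbitrary: q rule: less_induct)
  case less
  show ?case
  proof (cases "degree q = 0")
    case True
    then obtain c where "q = [:c:]"
      by (rule degree_eq_zeroE)
    with less.prems have "c \<noteq> 0" and "c \<cdot>\<^sub>v v = 0\<^sub>v n"
      by (auto simp: poly_mat_vec_const)
    with v v0 show ?thesis
      by (simp add: smult_vec_eq_0_iff)
  next
    case False
    then obtain \<beta> where "poly q \<beta> = 0"
      using closed by (auto simp: alg_closed_field_def)
    then obtain r where q: "q = [:-\<beta>, 1:] * r"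
      by (auto simp: poly_eq_0_iff_dvd elim: dvdE)
    with less.prems have "r \<noteq> 0"
      by auto
    show ?thesis
    proof (cases "poly_mat_vec B r v = 0\<^sub>v n")
      case True
      have "degree r < degree q"
        unfolding q using \<open>r \<noteq> 0\<close> by (subst degree_mult_eq) auto
      then show ?thesis
        using less.hyps \<open>r \<noteq> 0\<close> True by blast
    next
      case False
      have "B *\<^sub>v poly_mat_vec B r v - \<beta> \<cdot>\<^sub>v poly_mat_vec B r v = 0\<^sub>v n"
        using less.prems(2) unfolding q poly_mat_vec_linear_factor .
      then have "B *\<^sub>v poly_mat_vec B r v = \<beta> \<cdot>\<^sub>v poly_mat_vec B r v"
        using B by (simp add: diff_vec_eq_0_iff[of _ n])
      with False show ?thesis
        by blast
    qed
  qed
qed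

lemma common_eigenvector_commuting:
  assumes "alg_closed_field TYPE('a)" and "v \<noteq> 0\<^sub>v n"
  shows "\<exists>w \<beta>. eigenvector B w \<beta> \<and>
    (\<forall>A \<alpha>. A \<in> carrier_mat n n \<longrightarrow> A * B = B * A \<longrightarrow> A *\<^sub>v v = \<alpha> \<cdot>\<^sub>v v \<longrightarrow> A *\<^sub>v w = \<alpha> \<cdot>\<^sub>v w)"
proof -
  obtain q where "q \<noteq> 0" "poly_mat_vec B q v = 0\<^sub>v n"
    using poly_mat_vec_annihilator_exists by blast
  then obtain p \<beta> where "poly_mat_vec B p v \<noteq> 0\<^sub>v n"
    and "B *\<^sub>v poly_mat_vec B p v = \<beta> \<cdot>\<^sub>v poly_mat_vec B p v"
    using poly_mat_vec_eigenvector_exists[OF assms] by blast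
  with B show ?thesis
    unfolding eigenvector_def using poly_mat_vec_commute
    by (intro exI[of _ "poly_mat_vec B p v"] exI[of _ \<beta>]) auto
qed

end

lemma joint_eigenvector_commuting:
  fixes A B C :: "'a::field mat"
  assumes closed: "alg_closed_field TYPE('a)"
    and A: "A \<in> carrier_mat n n" and B: "B \<in> carrier_mat n n" and C: "C \<in> carrier_mat n n"
    and AB: "A * B = B * A" and AC: "A * C = C * A" and BC: "B * C = C * B"
    and "eigenvalue A \<alpha>"
  shows "\<exists>w \<beta> \<gamma>. eigenvector A w \<alpha> \<and> eigenvector B w \<beta> \<and> eigenvector C w \<gamma>"
proof -
  obtain v where v: "v \<in> carrier_vec n" "v \<noteq> 0\<^sub>v n" "A *\<^sub>v v = \<alpha> \<cdot>\<^sub>v v"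
    using \<open>eigenvalue A \<alpha>\<close> A unfolding eigenvalue_def eigenvector_def by auto
  obtain u \<beta> where u: "eigenvector B u \<beta>" and "A *\<^sub>v u = \<alpha> \<cdot>\<^sub>v u"
    using common_eigenvector_commuting[OF B v(1) closed v(2)] A AB v(3) by blast
  moreover obtain w \<gamma> where "eigenvector C w \<gamma>"
    and "\<forall>D \<delta>. D \<in> carrier_mat n n \<longrightarrow> D * C = C * D \<longrightarrow> D *\<^sub>v u = \<delta> \<cdot>\<^sub>v u \<longrightarrow> D *\<^sub>v w = \<delta> \<cdot>\<^sub>v w"
    using common_eigenvector_commuting[OF C, of u] u B closed unfolding eigenvector_def by auto
  ultimately show ?thesis
    using A B C AC BC unfolding eigenvector_def by auto
qed

section \<open>Linear extension of a family of matrices\<close>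

lemma lincomb_mat_carrier [simp]: "lincomb_mat n c M \<in> carrier_mat n n"
  by (simp add: lincomb_mat_def)

lemma index_lincomb_mat [simp]:
  "i < n \<Longrightarrow> j < n \<Longrightarrow> lincomb_mat n c M $$ (i, j) = (\<Sum>k\<in>UNIV. c k * M k $$ (i, j))"
  "dim_row (lincomb_mat n c M) = n" "dim_col (lincomb_mat n c M) = n"
  by (simp_all add: lincomb_mat_def)

lemma lincomb_mat_commute:
  fixes M :: "'i::finite \<Rightarrow> 'a::field mat"
  assumes X: "X \<in> carrier_mat n n" and M: "\<And>k. M k \<in> carrier_mat n n"
    and XM: "\<And>k. X * M k = M k * X"
  shows "X * lincomb_mat n c M = lincomb_mat n c M * X"
proof (rule eq_matI)
  fix i j assume "i < dim_row (lincomb_mat n c M * X)" "j < dim_col (lincomb_mat n c M * X)"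
  then have ij: "i < n" "j < n"
    using X by auto
  have dim_M: "dim_row (M k) = n" "dim_col (M k) = n" for k
    using M by auto
  have "(X * lincomb_mat n c M) $$ (i, j) = (\<Sum>k\<in>UNIV. c k * (X * M k) $$ (i, j))"
    using X dim_M ij
    by (simp add: scalar_prod_def sum_distrib_left mult.left_commute sum.swap[of _ UNIV])
  also have "\<dots> = (lincomb_mat n c M * X) $$ (i, j)"
    using X dim_M ij
    by (simp add: XM scalar_prod_def sum_distrib_left sum_distrib_right mult.assoc sum.swap[of _ UNIV])
  finally show "(X * lincomb_mat n c M) $$ (i, j) = (lincomb_mat n c M * X) $$ (i, j)" .
qed (use X in auto)

lemma lincomb_mat_smult: "lincomb_mat n (\<lambda>k. a * c k) M = a \<cdot>\<^sub>m lincomb_mat n c M"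
  by (rule eq_matI) (simp_all add: sum_distrib_left mult.assoc)

lemma lincomb_mat_cmult:
  fixes M :: "'i::finite \<Rightarrow> 'a::field mat"
  assumes M: "\<And>k. M k \<in> carrier_mat n n"
    and mult: "\<And>i j. M i * M j = lincomb_mat n (tm i j) M"
  shows "lincomb_mat n (cmult tm a b) M = lincomb_mat n a M * lincomb_mat n b M"
proof (rule eq_matI)
  fix p q assume "p < dim_row (lincomb_mat n a M * lincomb_mat n b M)"
    "q < dim_col (lincomb_mat n a M * lincomb_mat n b M)"
  then have pq: "p < n" "q < n"
    by auto
  have dim_M: "dim_row (M k) = n" "dim_col (M k) = n" for k
    using M by auto
  have "lincomb_mat n (cmult tm a b) M $$ (p, q)
      = (\<Sum>k\<in>UNIV. \<Sum>i\<in>UNIV. \<Sum>j\<in>UNIV. a i * b j * (tm i j k * M k $$ (p, q)))"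
    using pq by (simp add: cmult_def sum_distrib_right mult.assoc)
  also have "\<dots> = (\<Sum>i\<in>UNIV. \<Sum>j\<in>UNIV. a i * b j * lincomb_mat n (tm i j) M $$ (p, q))"
    unfolding index_lincomb_mat(1)[OF pq] sum_distrib_left
    by (subst sum.swap) (rule sum.cong[OF refl], rule sum.swap)
  also have "\<dots> = (\<Sum>i\<in>UNIV. \<Sum>j\<in>UNIV. \<Sum>r<n. a i * M i $$ (p, r) * (b j * M j $$ (r, q)))"
    using pq dim_M by (simp add: mult[symmetric] scalar_prod_def atLeast0LessThan sum_distrib_left
        mult.assoc mult.left_commute)
  also have "\<dots> = (\<Sum>r<n. \<Sum>i\<in>UNIV. \<Sum>j\<in>UNIV. a i * M i $$ (p, r) * (b j * M j $$ (r, q)))"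
    by (subst sum.swap) (rule sum.cong[OF refl], rule sum.swap)
  also have "\<dots> = (lincomb_mat n a M * lincomb_mat n b M) $$ (p, q)"
    using pq by (simp add: scalar_prod_def atLeast0LessThan sum_product)
  finally show "lincomb_mat n (cmult tm a b) M $$ (p, q)
      = (lincomb_mat n a M * lincomb_mat n b M) $$ (p, q)" .
qed auto

lemma index_lincomb_mat_mult_vec:
  fixes M :: "'i::finite \<Rightarrow> 'a::field mat"
  assumes M: "\<And>k. M k \<in> carrier_mat n n" and w: "w \<in> carrier_vec n" and i: "i < n"
  shows "(lincomb_mat n c M *\<^sub>v w) $ i = (\<Sum>k\<in>UNIV. c k * (M k *\<^sub>v w) $ i)"
proof -
  have dim_M: "dim_row (M k) = n" "dim_col (M k) = n" for k
    using M by auto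
  show ?thesis
    using i w dim_M by (simp add: scalar_prod_def sum_distrib_left sum_distrib_right mult.assoc
        sum.swap[of _ UNIV])
qed

lemma eigenvalue_root_of_annihilating_poly:
  fixes M :: "'i::finite \<Rightarrow> 'a::field mat"
  assumes M: "\<And>k. M k \<in> carrier_mat n n"
    and unit: "lincomb_mat n u M = 1\<^sub>m n"
    and intertwine: "\<And>c. lincomb_mat n (f c) M = Z * lincomb_mat n c M"
    and annihilate: "op_poly m f u = (\<lambda>_. 0)"
    and eigen: "eigenvector Z w \<eta>" and Z: "Z \<in> carrier_mat n n"
  shows "poly m \<eta> = 0"
proof -
  from eigen Z have w: "w \<in> carrier_vec n" "w \<noteq> 0\<^sub>v n" and Zw: "Z *\<^sub>v w = \<eta> \<cdot>\<^sub>v w"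
    by (auto simp: eigenvector_def)
  then obtain i where i: "i < n" "w $ i \<noteq> 0"
    by (metis carrier_vecD eq_vecI index_zero_vec)
  have powers: "lincomb_mat n ((f ^^ k) u) M *\<^sub>v w = \<eta> ^ k \<cdot>\<^sub>v w" for k
  proof (induction k)
    case (Suc k)
    have "lincomb_mat n ((f ^^ Suc k) u) M *\<^sub>v w = Z *\<^sub>v (lincomb_mat n ((f ^^ k) u) M *\<^sub>v w)"
      unfolding funpow.simps(2) o_apply intertwine using Z w by (intro assoc_mult_mat_vec) auto
    then show ?case
      using Z w by (simp add: Suc mult_mat_vec Zw smult_smult_assoc mult.commute)
  qed (use unit w in simp)
  have "0 = (lincomb_mat n (op_poly m f u) M *\<^sub>v w) $ i"
    unfolding annihilate index_lincomb_mat_mult_vec[OF M w(1) i(1)] by simp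
  also have "\<dots> = (\<Sum>k\<le>degree m. coeff m k * (lincomb_mat n ((f ^^ k) u) M *\<^sub>v w) $ i)"
    unfolding index_lincomb_mat_mult_vec[OF M w(1) i(1)]
    by (simp add: op_poly_def sum_distrib_left sum_distrib_right
        mult.assoc sum.swap[of _ UNIV])
  also have "\<dots> = poly m \<eta> * w $ i"
    using w i by (simp add: powers poly_altdef sum_distrib_right mult.assoc)
  finally show ?thesis
    using i by simp
qed

section \<open>Conjugation by a solution of a quadratic relation\<close>

lemma assoc3_mult_mat_vec:
  assumes "A \<in> carrier_mat n n" "B \<in> carrier_mat n n" "C \<in> carrier_mat n n" "v \<in> carrier_vec n"
  shows "(A * B * C) *\<^sub>v v = A *\<^sub>v (B *\<^sub>v (C *\<^sub>v v))"
proof -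
  have "(A * B * C) *\<^sub>v v = (A * B) *\<^sub>v (C *\<^sub>v v)"
    using assms by (intro assoc_mult_mat_vec) auto
  also have "\<dots> = A *\<^sub>v (B *\<^sub>v (C *\<^sub>v v))"
    using assms by (intro assoc_mult_mat_vec) auto
  finally show ?thesis .
qed

lemma hecke_relation_mult_vec:
  fixes S Z :: "'a::field mat"
  assumes S: "S \<in> carrier_mat n n" and Z: "Z \<in> carrier_mat n n"
    and hecke: "S * S = Z * S + 1\<^sub>m n" and u: "u \<in> carrier_vec n"
  shows "S *\<^sub>v (S *\<^sub>v u) = Z *\<^sub>v (S *\<^sub>v u) + u"
proof -
  have "S *\<^sub>v (S *\<^sub>v u) = (S * S) *\<^sub>v u"
    using S u by (simp add: assoc_mult_mat_vec)
  also have "\<dots> = (Z * S + 1\<^sub>m n) *\<^sub>v u"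
    by (simp only: hecke)
  also have "\<dots> = Z *\<^sub>v (S *\<^sub>v u) + u"
    using S Z u by (simp add: add_mult_distrib_mat_vec[of _ n n] assoc_mult_mat_vec)
  finally show ?thesis .
qed

context
  fixes S Z X :: "'a::field mat" and w :: "'a vec" and n :: nat and \<eta> \<nu> :: 'a
  assumes S: "S \<in> carrier_mat n n" and Z: "Z \<in> carrier_mat n n" and X: "X \<in> carrier_mat n n"
    and hecke: "S * S = Z * S + 1\<^sub>m n"
    and w: "w \<in> carrier_vec n" and Zw: "Z *\<^sub>v w = \<eta> \<cdot>\<^sub>v w"
    and conj: "(S * X * S) *\<^sub>v w = \<nu> \<cdot>\<^sub>v w"
begin

lemma hecke_conj_mult_vec: "S *\<^sub>v (X *\<^sub>v (S *\<^sub>v w)) = \<nu> \<cdot>\<^sub>v w"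
  using conj assoc3_mult_mat_vec[OF S X S w] by simp

lemma hecke_image_mult_vec: "X *\<^sub>v (S *\<^sub>v w) = \<nu> \<cdot>\<^sub>v (S *\<^sub>v w) - (\<nu> * \<eta>) \<cdot>\<^sub>v w"
proof -
  have "S *\<^sub>v (\<nu> \<cdot>\<^sub>v w) = Z *\<^sub>v (\<nu> \<cdot>\<^sub>v w) + X *\<^sub>v (S *\<^sub>v w)"
    using hecke_relation_mult_vec[OF S Z hecke, of "X *\<^sub>v (S *\<^sub>v w)"] S X w
    by (simp only: hecke_conj_mult_vec) simp
  then have "\<nu> \<cdot>\<^sub>v (S *\<^sub>v w) = (\<nu> * \<eta>) \<cdot>\<^sub>v w + X *\<^sub>v (S *\<^sub>v w)"
    by (simp only: mult_mat_vec[OF S w] mult_mat_vec[OF Z w] Zw smult_smult_assoc)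
  then show ?thesis
    using S X w by (auto simp: vec_eq_iff)
qed

lemma hecke_eigenvector_candidate:
  assumes Xw: "X *\<^sub>v w = lam \<cdot>\<^sub>v w"
  defines "y \<equiv> X *\<^sub>v (S *\<^sub>v w) - lam \<cdot>\<^sub>v (S *\<^sub>v w)"
  shows "X *\<^sub>v y = \<nu> \<cdot>\<^sub>v y"
proof -
  let ?s = "S *\<^sub>v w" and ?x = "X *\<^sub>v (S *\<^sub>v w)"
  have s: "?s \<in> carrier_vec n" and x: "?x \<in> carrier_vec n"
    using S X w by simp_all
  have x_index: "?x $ i = \<nu> * ?s $ i - \<nu> * \<eta> * w $ i" if "i < n" for i
    using that S w by (simp add: hecke_image_mult_vec)
  have "X *\<^sub>v ?x = X *\<^sub>v (\<nu> \<cdot>\<^sub>v ?s - (\<nu> * \<eta>) \<cdot>\<^sub>v w)"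
    by (simp only: hecke_image_mult_vec)
  also have "\<dots> = \<nu> \<cdot>\<^sub>v ?x - (\<nu> * \<eta> * lam) \<cdot>\<^sub>v w"
    using X s w by (simp add: mult_minus_distrib_mat_vec mult_mat_vec Xw smult_smult_assoc)
  finally have "X *\<^sub>v y = \<nu> \<cdot>\<^sub>v ?x - (\<nu> * \<eta> * lam) \<cdot>\<^sub>v w - lam \<cdot>\<^sub>v ?x"
    using X s unfolding y_def by (simp add: mult_minus_distrib_mat_vec mult_mat_vec)
  also have "\<dots> = \<nu> \<cdot>\<^sub>v y"
    unfolding y_def using x s w
    by (intro eq_vecI)
      (simp_all add: x_index carrier_matD[OF X] carrier_matD[OF S] algebra_simps del: index_mult_mat_vec)
  finally show ?thesis .
qed

lemma hecke_eigenvalue_cases: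
  assumes Xw: "X *\<^sub>v w = lam \<cdot>\<^sub>v w" and w0: "w \<noteq> 0\<^sub>v n"
  shows "eigenvalue X \<nu> \<or> \<nu> = lam \<or> (\<exists>\<mu>. \<mu>^2 - \<mu> * \<eta> - 1 = 0 \<and> \<nu> = \<mu>^2 * lam)"
proof -
  let ?s = "S *\<^sub>v w"
  have s: "?s \<in> carrier_vec n"
    using S w by simp
  define y where "y = X *\<^sub>v ?s - lam \<cdot>\<^sub>v ?s"
  consider "y \<noteq> 0\<^sub>v n" | "\<nu> = lam" | "y = 0\<^sub>v n" "\<nu> \<noteq> lam"
    by blast
  then show ?thesis
  proof cases
    case 1
    moreover have "y \<in> carrier_vec n"
      using X s by (simp add: y_def)
    ultimately have "eigenvalue X \<nu>"
      using hecke_eigenvector_candidate[OF Xw] X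
      unfolding eigenvalue_def eigenvector_def y_def by auto
    then show ?thesis ..
  next
    case 3
    define \<mu> where "\<mu> = \<nu> * \<eta> / (\<nu> - lam)"
    have "X *\<^sub>v ?s = lam \<cdot>\<^sub>v ?s"
      using 3 X s by (simp add: y_def diff_vec_eq_0_iff[of _ n])
    then have s_eq: "?s = \<mu> \<cdot>\<^sub>v w"
      using 3 s w unfolding hecke_image_mult_vec by (auto simp: vec_eq_iff \<mu>_def field_simps)
    have "(\<mu>^2 - \<mu> * \<eta> - 1) \<cdot>\<^sub>v w = 0\<^sub>v n"
      using hecke_relation_mult_vec[OF S Z hecke w] S Z w
      by (simp add: s_eq mult_mat_vec Zw vec_eq_iff power2_eq_square algebra_simps)
    moreover have "(\<nu> - \<mu>^2 * lam) \<cdot>\<^sub>v w = 0\<^sub>v n"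
      using hecke_conj_mult_vec S X w
      by (auto simp: s_eq mult_mat_vec Xw vec_eq_iff power2_eq_square algebra_simps)
    ultimately show ?thesis
      using w w0 by (auto simp: smult_vec_eq_0_iff)
  qed simp
qed

end

section \<open>Modules over \<open>QAWA\<^sub>2\<close>\<close>

lemma sq_mem_Gamma_R:
  assumes quadratic: "\<mu>^2 - \<mu> * \<eta> - 1 = 0" and root: "poly m \<eta> = 0"
  shows "\<mu>^2 \<in> Gamma_R m"
proof -
  have "(\<mu> - \<eta>) * \<mu> = 1"
    using quadratic by (simp add: power2_eq_square algebra_simps)
  then have "\<mu> / (\<mu> - \<eta>) = \<mu>^2"
    by (simp add: divide_inverse inverse_unique power2_eq_square)
  moreover have "1 * (\<mu> / (\<mu> - \<eta>)) \<in> Gamma_R m"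
    unfolding Gamma_R_def using quadratic root
    by (intro gen_mult_subgroup.mul gen_mult_subgroup.one) blast
  ultimately show ?thesis
    by simp
qed

lemma qawa2_module_tau:
  assumes "qawa2_module mR uR pR mA uA pA dual \<iota> z n \<rho> X1 X2 S"
  defines "Z \<equiv> \<iota> z \<cdot>\<^sub>m lincomb_mat n (ttau uR dual \<iota>) \<rho>"
  shows "Z \<in> carrier_mat n n" and "X1 * Z = Z * X1" and "X2 * Z = Z * X2" and "S * S = Z * S + 1\<^sub>m n"
proof -
  let ?T = "lincomb_mat n (ttau uR dual \<iota>) \<rho>"
  have \<rho>: "\<And>i. \<rho> i \<in> carrier_mat n n" and X1: "X1 \<in> carrier_mat n n" and X2: "X2 \<in> carrier_mat n n"
    and S: "S \<in> carrier_mat n n"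
    using assms(1) unfolding qawa2_module_def by auto
  show "Z \<in> carrier_mat n n"
    by (simp add: Z_def)
  have "X * Z = Z * X" if X: "X \<in> carrier_mat n n" and X\<rho>: "\<And>i. X * \<rho> i = \<rho> i * X" for X
  proof -
    have "X * ?T = ?T * X"
      by (rule lincomb_mat_commute[OF X \<rho> X\<rho>])
    then show ?thesis
      using X unfolding Z_def by (simp add: mult_smult_distrib[OF X lincomb_mat_carrier]
          mult_smult_assoc_mat[OF lincomb_mat_carrier X])
  qed
  then show "X1 * Z = Z * X1" and "X2 * Z = Z * X2"
    using assms(1) X1 X2 unfolding qawa2_module_def by auto
  show "S * S = Z * S + 1\<^sub>m n"
    using assms(1) unfolding qawa2_module_def Z_def
    by (simp add: mult_smult_assoc_mat[OF lincomb_mat_carrier S])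
qed

lemma qawa2_module_tau_eigenvalue_root:
  assumes min_poly: "is_min_poly (\<lambda>v. (\<lambda>k. \<iota> z * cmult (tmul mR pR mA pA \<iota>) (ttau uR dual \<iota>) v k)) m"
    and module: "qawa2_module mR uR pR mA uA pA dual \<iota> z n \<rho> X1 X2 S"
    and eigen: "eigenvector (\<iota> z \<cdot>\<^sub>m lincomb_mat n (ttau uR dual \<iota>) \<rho>) w \<eta>"
  shows "poly m \<eta> = 0"
proof (rule eigenvalue_root_of_annihilating_poly[OF _ _ _ _ eigen])
  have \<rho>: "\<And>i. \<rho> i \<in> carrier_mat n n"
    and mult: "\<And>i j. \<rho> i * \<rho> j = lincomb_mat n (tmul mR pR mA pA \<iota> i j) \<rho>"
    using module unfolding qawa2_module_def by auto
  show "\<And>k. \<rho> k \<in> carrier_mat n n"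
    by (fact \<rho>)
  show "lincomb_mat n (tunit uR uA \<iota>) \<rho> = 1\<^sub>m n"
    using module unfolding qawa2_module_def by auto
  show "lincomb_mat n (\<lambda>k. \<iota> z * cmult (tmul mR pR mA pA \<iota>) (ttau uR dual \<iota>) c k) \<rho>
      = (\<iota> z \<cdot>\<^sub>m lincomb_mat n (ttau uR dual \<iota>) \<rho>) * lincomb_mat n c \<rho>" for c
    by (simp add: lincomb_mat_smult lincomb_mat_cmult[OF \<rho> mult]
        mult_smult_assoc_mat[OF lincomb_mat_carrier lincomb_mat_carrier])
  show "op_poly m (\<lambda>v k. \<iota> z * cmult (tmul mR pR mA pA \<iota>) (ttau uR dual \<iota>) v k) (tunit uR uA \<iota>)
      = (\<lambda>_. 0)"
    using min_poly unfolding is_min_poly_def by blast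
qed simp

theorem lemma8p3:
  fixes \<iota> :: "'k::comm_ring_1 \<Rightarrow> 'K::field"
    and z :: 'k
    and mA :: "'b::finite \<Rightarrow> 'b \<Rightarrow> 'b \<Rightarrow> 'k" and uA :: "'b \<Rightarrow> 'k" and pA :: "'b \<Rightarrow> bool"
    and tr :: "'b \<Rightarrow> 'k" and dual :: "'b \<Rightarrow> 'b \<Rightarrow> 'k"
    and mR :: "'r::finite \<Rightarrow> 'r \<Rightarrow> 'r \<Rightarrow> 'K" and uR :: "'r \<Rightarrow> 'K" and pR :: "'r \<Rightarrow> bool"
    and m :: "'K poly"
    and n :: nat and \<rho> :: "'r \<times> 'b \<times> 'b \<Rightarrow> 'K mat" and X1 X2 S :: "'K mat"
  assumes "alg_closed_field TYPE('K)"
    and "ring_embedding \<iota>"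
    and "\<exists>w. z * w = 1"
    and "sym_frob_superalg mA uA pA tr dual"
    and "supercomm_superalg mR uR pR"
    and "is_min_poly (\<lambda>v. (\<lambda>k. \<iota> z * cmult (tmul mR pR mA pA \<iota>) (ttau uR dual \<iota>) v k)) m"
    and "qawa2_module mR uR pR mA uA pA dual \<iota> z n \<rho> X1 X2 S"
  shows "\<forall>\<nu>. eigenvalue X2 \<nu> \<longrightarrow>
           (\<exists>lam. eigenvalue X1 lam \<and> (\<nu> = lam \<or> (\<exists>\<gamma>\<in>Gamma_R m. \<nu> = \<gamma> * lam)))"
proof (intro allI impI)
  fix \<nu> assume "eigenvalue X2 \<nu>"
  define Z where "Z = \<iota> z \<cdot>\<^sub>m lincomb_mat n (ttau uR dual \<iota>) \<rho>"
  note Z = qawa2_module_tau[OF assms(7), folded Z_def]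
  have X1: "X1 \<in> carrier_mat n n" and X2: "X2 \<in> carrier_mat n n" and S: "S \<in> carrier_mat n n"
    and "X1 * X2 = X2 * X1" and conj: "S * X1 * S = X2"
    using assms(7) unfolding qawa2_module_def by auto
  then obtain w \<eta> lam where X2w: "eigenvector X2 w \<nu>" and Zw: "eigenvector Z w \<eta>"
    and X1w: "eigenvector X1 w lam"
    using joint_eigenvector_commuting[OF assms(1) X2 Z(1) X1 Z(3)] Z(2) \<open>eigenvalue X2 \<nu>\<close> by metis
  have "poly m \<eta> = 0"
    using qawa2_module_tau_eigenvalue_root[OF assms(6,7)] Zw unfolding Z_def by blast
  moreover have "eigenvalue X1 \<nu> \<or> \<nu> = lam \<or> (\<exists>\<mu>. \<mu>^2 - \<mu> * \<eta> - 1 = 0 \<and> \<nu> = \<mu>^2 * lam)"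
    using hecke_eigenvalue_cases[OF S Z(1) X1 Z(4)] X1w X2w Zw X2 conj
    unfolding eigenvector_def by auto
  moreover have "eigenvalue X1 lam"
    using X1w unfolding eigenvalue_def by blast
  ultimately show "\<exists>lam. eigenvalue X1 lam \<and> (\<nu> = lam \<or> (\<exists>\<gamma>\<in>Gamma_R m. \<nu> = \<gamma> * lam))"
    using sq_mem_Gamma_R by blast
qed

end
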